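(* Let $f(x)=h(A(x))$, $f_\eta(x)=h_\eta(A(x))$ with $h$, $A$, $h_\eta$, $\mathcal{X}$, $B$, $D$, $L_A$, $\sigma$ as specified in the context, and $\eta>0$. Then: 1) $f_\eta(x)\le f(x)\le f_\eta(x)+\mathcal{R}_\eta(x)$ with $\mathcal{R}_\eta(x)\equiv\eta D$. 2) $f_\eta$ is continuously differentiable on $\mathcal{X}$ with gradient $\nabla f_\eta(x)=\nabla A(x)^\top y_{A(x)}$, where $y_z:=\arg\max_{y\in\mathbb{V}^*}\{\langle y,z\rangle-h^*(y)-\eta\,\omega(y)\}$. 3) $f_\eta$ is $BL_A$-weakly convex on $\mathcal{X}$ and satisfies $\|\nabla f_\eta(x_1)-\nabla f_\eta(x_2)\|\le\mathcal{L}_\eta(x_1,x_2)\|x_1-x_2\|$ for all $x_1,x_2\in\mathcal{X}$ with $$\mathcal{L}_\eta(x_1,x_2)=\frac{1}{\sigma\eta}\sup_{0\le\theta\le1}\|\nabla A(\theta x_1+(1-\theta)x_2)\|_{\mathrm{op}}^2+BL_A.$$ Consequently, $f_\eta$ is a $(BL_A,\mathcal{R}_\eta,\mathcal{L}_\eta)$-smooth approximation of $f$ on $\mathcal{X}$.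
   Context: $\mathbb{E}$ is a finite-dimensional Euclidean space with norm $\|\cdot\|$; $\mathbb{V}$ is a finite-dimensional vector space with a norm $\|\cdot\|_{\mathbb V}$ and dual $\mathbb{V}^*$ with dual norm $\|y\|_{\mathbb{V}^*}=\sup\{\langle x,y\rangle:\|x\|_{\mathbb V}\le1\}$. For linear $T:\mathbb{E}\to\mathbb{V}$, $\|T\|_{\mathrm{op}}=\sup_{\|x\|=1}\|Tx\|_{\mathbb V}$. $\mathcal{X}\subseteq\mathbb{E}$ is closed and convex. $A:\mathbb{E}\to\mathbb{V}$ is a continuously differentiable map with Jacobian $\nabla A(x)$, and $\|\nabla A(x)-\nabla A(\hat x)\|_{\mathrm{op}}\le L_A\|x-\hat x\|$ for all $x,\hat x\in\mathcal{X}$. $h:\mathbb{V}\to\mathbb{R}$ is convex and continuous, with conjugate $h^*(y)=\sup_{z\in\mathbb V}\{\langle z,y\rangle-h(z)\}$, and $\operatorname{dom}h^*$ is bounded. $\omega:\mathbb{V}^*\to\mathbb{R}\cup\{+\infty\}$ is a prox-function: lower semicontinuous, and differentiable and $\sigma$-strongly convex ($\sigma>0$) on $\operatorname{dom}h^*$ with respect to $\|\cdot\|_{\mathbb{V}^*}$, normalized so that $\min_{y\in\mathbb{V}^*}\omega(y)=0$. Set $B:=\sup\{\|y\|_{\mathbb{V}^*}:y\in\operatorname{dom}h^*\}$ and $D:=\sup\{\omega(y):y\in\operatorname{dom}h^*\}<\infty$. For $\eta>0$, $h_\eta(z):=\sup_{y\in\mathbb{V}^*}\{\langle y,z\rangle-h^*(y)-\eta\,\omega(y)\}$.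 A function $g$ is $\rho$-weakly convex on $\mathcal X$ if $g+\frac\rho2\|\cdot\|^2$ is convex on $\mathcal X$. For $f$ weakly convex on $\mathcal X$, a continuously differentiable $f_\eta$ is a $(\bar\rho,\mathcal{R}_\eta,\mathcal{L}_\eta)$-smooth approximation of $f$ on $\mathcal X$ (with $\bar\rho\ge0$ not depending on $\eta$, $\mathcal{R}_\eta:\mathcal X\to[0,\infty)$, $\mathcal{L}_\eta:\mathcal X\times\mathcal X\to[0,\infty)$ symmetric) if $f_\eta$ is $\bar\rho$-weakly convex, $f_\eta\le f\le f_\eta+\mathcal{R}_\eta$ on $\mathcal X$, and $\|\nabla f_\eta(x)-\nabla f_\eta(y)\|\le\mathcal{L}_\eta(x,y)\|x-y\|$ on $\mathcal X$. *)

theory Defs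
  imports "HOL-Analysis.Analysis"
begin

text \<open>
  The dual of a finite-dimensional normed space \<open>'v\<close> is the type \<open>'v \<Rightarrow>\<^sub>L real\<close>: in finite dimension
  every linear functional is bounded, and the norm of this type is the dual norm. Likewise the
  norm of \<open>'e \<Rightarrow>\<^sub>L 'v\<close> is the operator norm.
\<close>

definition conjugate :: "('v::real_normed_vector \<Rightarrow> real) \<Rightarrow> ('v \<Rightarrow>\<^sub>L real) \<Rightarrow> ereal" where
  "conjugate h y = (SUP z. ereal (blinfun_apply y z - h z))"

definition edom :: "('a \<Rightarrow> ereal) \<Rightarrow> 'a set" where
  "edom g = {y. g y < \<infinity>}"

definition lower_semicontinuous :: "('a::topological_space \<Rightarrow> ereal) \<Rightarrow> bool" where
  "lower_semicontinuous g \<longleftrightarrow> (\<forall>y. g y \<le> Liminf (at y) g)"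

definition strongly_convex_on :: "real \<Rightarrow> 'a::real_normed_vector set \<Rightarrow> ('a \<Rightarrow> real) \<Rightarrow> bool" where
  "strongly_convex_on \<sigma> S g \<longleftrightarrow> convex S \<and>
     (\<forall>x\<in>S. \<forall>y\<in>S. \<forall>t\<in>{0..1}.
        g (t *\<^sub>R x + (1 - t) *\<^sub>R y)
          \<le> t * g x + (1 - t) * g y - \<sigma> / 2 * t * (1 - t) * (norm (x - y))\<^sup>2)"

definition weakly_convex_on :: "real \<Rightarrow> 'a::real_normed_vector set \<Rightarrow> ('a \<Rightarrow> real) \<Rightarrow> bool" where
  "weakly_convex_on \<rho> S g \<longleftrightarrow> convex_on S (\<lambda>x. g x + \<rho> / 2 * (norm x)\<^sup>2)"

text \<open>
  \<open>S\<close> plays the role of the domain of the conjugate. It may have empty interior, so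
  differentiability on \<open>S\<close> is taken relative to \<open>S\<close>, as in \<open>differentiable_on\<close>.
  The last two conjuncts say that the minimum of \<open>\<omega>\<close> is attained and equals 0.
\<close>

definition prox_function ::
    "real \<Rightarrow> 'a::real_normed_vector set \<Rightarrow> ('a \<Rightarrow> ereal) \<Rightarrow> bool" where
  "prox_function \<sigma> S \<omega> \<longleftrightarrow>
     (\<forall>y. \<omega> y \<noteq> -\<infinity>) \<and>
     lower_semicontinuous \<omega> \<and>
     (\<forall>y\<in>S. \<omega> y < \<infinity>) \<and>
     (\<lambda>y. real_of_ereal (\<omega> y)) differentiable_on S \<and>
     strongly_convex_on \<sigma> S (\<lambda>y. real_of_ereal (\<omega> y)) \<and>
     (\<forall>y. 0 \<le> \<omega> y) \<and> (\<exists>y. \<omega> y = 0)"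

text \<open>
  Neither the conjugate nor \<open>\<omega>\<close> takes the value \<open>-\<infinity>\<close>, so for \<open>\<eta> > 0\<close> the difference below never
  hits an undefined combination of infinities: it is \<open>-\<infinity>\<close> as soon as one of the two is \<open>\<infinity>\<close>.
\<close>

definition smoothing_objective ::
    "('v::real_normed_vector \<Rightarrow> real) \<Rightarrow> (('v \<Rightarrow>\<^sub>L real) \<Rightarrow> ereal) \<Rightarrow> real \<Rightarrow> 'v \<Rightarrow> ('v \<Rightarrow>\<^sub>L real) \<Rightarrow> ereal"
  where
  "smoothing_objective h \<omega> \<eta> z y = ereal (blinfun_apply y z) - conjugate h y - ereal \<eta> * \<omega> y"

definition smoothing ::
    "('v::real_normed_vector \<Rightarrow> real) \<Rightarrow> (('v \<Rightarrow>\<^sub>L real) \<Rightarrow> ereal) \<Rightarrow> real \<Rightarrow> 'v \<Rightarrow> ereal" where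
  "smoothing h \<omega> \<eta> z = (SUP y. smoothing_objective h \<omega> \<eta> z y)"

text \<open>
  The transpose maps the dual of \<open>'v\<close> to \<open>'e\<close>, the latter being identified with its own dual
  through the inner product; \<open>inner_blinfun_transpose\<close> is the characteristic property.
\<close>

definition blinfun_transpose ::
    "('e::euclidean_space \<Rightarrow>\<^sub>L 'v::real_normed_vector) \<Rightarrow> ('v \<Rightarrow>\<^sub>L real) \<Rightarrow> 'e" where
  "blinfun_transpose T y = (\<Sum>b\<in>Basis. blinfun_apply y (blinfun_apply T b) *\<^sub>R b)"

lemma inner_blinfun_transpose:
  "blinfun_transpose T y \<bullet> v = blinfun_apply y (blinfun_apply T v)"
proof -
  have "blinfun_apply y (blinfun_apply T v)
      = blinfun_apply y (blinfun_apply T (\<Sum>b\<in>Basis. (v \<bullet> b) *\<^sub>R b))"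
    by (simp add: euclidean_representation)
  also have "\<dots> = (\<Sum>b\<in>Basis. (v \<bullet> b) * blinfun_apply y (blinfun_apply T b))"
    by (simp add: blinfun.sum_right blinfun.scaleR_right)
  also have "\<dots> = blinfun_transpose T y \<bullet> v"
    by (simp add: blinfun_transpose_def inner_sum_left inner_commute[of v] mult.commute)
  finally show ?thesis by simp
qed

definition gradient :: "('e::real_inner \<Rightarrow> real) \<Rightarrow> 'e \<Rightarrow> 'e" where
  "gradient g x = (THE D. GDERIV g x :> D)"

definition continuously_differentiable_on :: "'e::real_inner set \<Rightarrow> ('e \<Rightarrow> real) \<Rightarrow> bool" where
  "continuously_differentiable_on X g \<longleftrightarrow>
     (\<forall>x\<in>X. GDERIV g x :> gradient g x) \<and> continuous_on X (gradient g)"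

definition smooth_approximation ::
    "'e::real_inner set \<Rightarrow> ('e \<Rightarrow> real) \<Rightarrow> ('e \<Rightarrow> real) \<Rightarrow> real \<Rightarrow> ('e \<Rightarrow> real) \<Rightarrow> ('e \<Rightarrow> 'e \<Rightarrow> real) \<Rightarrow> bool"
  where
  "smooth_approximation X f g \<rho> R L \<longleftrightarrow>
     (\<exists>r\<ge>0. weakly_convex_on r X f) \<and>
     0 \<le> \<rho> \<and>
     (\<forall>x\<in>X. 0 \<le> R x) \<and>
     (\<forall>x\<in>X. \<forall>y\<in>X. 0 \<le> L x y \<and> L x y = L y x) \<and>
     continuously_differentiable_on X g \<and>
     weakly_convex_on \<rho> X g \<and>
     (\<forall>x\<in>X. g x \<le> f x \<and> f x \<le> g x + R x) \<and>
     (\<forall>x\<in>X. \<forall>y\<in>X. norm (gradient g x - gradient g y) \<le> L x y * norm (x - y))"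

end

(*
  The objective defining h_eta is eta sigma-strongly concave on dom h^*, so it has a unique maximizer
  y_z with quadratic growth around it. Comparing the growth inequalities at z and z' makes
  z |-> y_z Lipschitz with constant 1/(sigma eta), and a function with a Lipschitz selection of
  subgradients is differentiable with that selection as derivative. Conversely h has a subgradient in
  dom h^* at every point (Hahn-Banach), which gives h = h^** and the bound f <= f_eta + eta D.
  Both h and h_eta thus have subgradients of norm at most B everywhere; composing such a function with
  a map whose Jacobian is L_A-Lipschitz costs at most B L_A in convexity, because the linearization
  error of y o A is at most |y| L_A / 2 times the squared distance.
*)
theory Submission
  imports Defs
begin

section \<open>Hahn-Banach domination and subgradients of convex functions\<close>

text \<open>
  The extension step of the Hahn-Banach theorem; the majorant need only be convex, not sublinear.
\<close>

lemma convex_dominated_extension_step: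
  fixes h :: "'v::real_vector \<Rightarrow> real"
  assumes h: "convex_on UNIV h" and l: "linear l" and le: "\<And>x. x \<in> span K \<Longrightarrow> l x \<le> h x"
    and indep: "independent (insert v K)" and v: "v \<notin> K"
  obtains l' where "linear l'" "\<And>x. x \<in> span (insert v K) \<Longrightarrow> l' x \<le> h x"
proof -
  \<comment> \<open>Domination dictates lower bounds (from steps along \<open>- v\<close>) and upper
    bounds (from steps along \<open>v\<close>) for the value at \<open>v\<close>. Convexity keeps
    all lower bounds below all upper ones.\<close>
  have cross: "(l w' - h (w' - s *\<^sub>R v)) / s \<le> (h (w + t *\<^sub>R v) - l w) / t"
    if "s > 0" "t > 0" "w \<in> span K" "w' \<in> span K" for s t w w'
  proof -
    \<comment> \<open>These weights cancel the \<open>v\<close>-components, so the convex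
      combination falls back into \<open>span K\<close>, where \<open>l\<close> is already
      dominated.\<close>
    let ?a = "s / (s + t)"
    have a: "0 \<le> ?a" "?a \<le> 1" "1 - ?a = t / (s + t)" using that by (auto simp: field_simps)
    have "?a *\<^sub>R (w + t *\<^sub>R v) + (1 - ?a) *\<^sub>R (w' - s *\<^sub>R v) = ?a *\<^sub>R w + (1 - ?a) *\<^sub>R w'"
      unfolding a(3) by (simp add: algebra_simps)
    then have "h (?a *\<^sub>R w + (1 - ?a) *\<^sub>R w') \<le> ?a * h (w + t *\<^sub>R v) + (1 - ?a) * h (w' - s *\<^sub>R v)"
      using convex_onD[OF h a(1,2), of "w' - s *\<^sub>R v" "w + t *\<^sub>R v"] by (simp add: add.commute)
    moreover have "l (?a *\<^sub>R w + (1 - ?a) *\<^sub>R w') \<le> h (?a *\<^sub>R w + (1 - ?a) *\<^sub>R w')"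
      using that by (intro le span_add span_scale)
    moreover have "l (?a *\<^sub>R w + (1 - ?a) *\<^sub>R w') = ?a * l w + (1 - ?a) * l w'"
      by (simp add: linear_add[OF l] linear_scale[OF l])
    ultimately have "?a * l w + (1 - ?a) * l w' \<le> ?a * h (w + t *\<^sub>R v) + (1 - ?a) * h (w' - s *\<^sub>R v)"
      by linarith
    then have "(s * l w + t * l w') / (s + t) \<le> (s * h (w + t *\<^sub>R v) + t * h (w' - s *\<^sub>R v)) / (s + t)"
      unfolding a(3) by (simp add: add_divide_distrib)
    then have "s * l w + t * l w' \<le> s * h (w + t *\<^sub>R v) + t * h (w' - s *\<^sub>R v)"
      using that by (simp add: divide_le_cancel)
    then show ?thesis using that by (simp add: field_simps)
  qed
  define P where "P = {(l w - h (w - s *\<^sub>R v)) / s | s w. s > 0 \<and> w \<in> span K}"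
  \<comment> \<open>\<open>c\<close> is the value the extension will take at \<open>v\<close>; any
    number between the two families of slopes would serve.\<close>
  define c where "c = Sup P"
  have upper: "c \<le> (h (w + t *\<^sub>R v) - l w) / t" if "t > 0" "w \<in> span K" for t w
    unfolding c_def
  proof (rule cSup_least)
    have "(l 0 - h (0 - 1 *\<^sub>R v)) / 1 \<in> P"
      unfolding P_def by (intro CollectI exI[of _ "1::real"] exI[of _ 0]) (simp add: span_0)
    then show "P \<noteq> {}" by blast
  qed (use cross that in \<open>auto simp: P_def\<close>)
  have lower: "(l w - h (w - s *\<^sub>R v)) / s \<le> c" if "s > 0" "w \<in> span K" for s w
    unfolding c_def
  proof (rule cSup_upper)
    show "bdd_above P"
      unfolding P_def by (rule bdd_aboveI[of _ "(h (0 + 1 *\<^sub>R v) - l 0) / 1"])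
        (use cross[of _ 1 0] span_0 in force)
  qed (use that in \<open>auto simp: P_def\<close>)
  \<comment> \<open>\<open>g\<close> reads off the coefficient of \<open>v\<close>, so correcting
    \<open>l\<close> by a multiple of \<open>g\<close> changes nothing on
    \<open>span K\<close>.\<close>
  obtain g where g: "linear g" "\<forall>x\<in>insert v K. g x = (if x = v then 1 else 0::real)"
    using linear_independent_extend[OF indep, of "\<lambda>x. if x = v then 1 else 0::real"] by auto
  have g0: "g x = 0" if "x \<in> span K" for x
    by (rule linear_eq_0_on_span[OF g(1) _ that]) (use g(2) v in auto)
  define l' where "l' x = l x + (c - l v) * g x" for x
  show ?thesis
  proof
    show "linear l'"
      unfolding l'_def using l g(1) by (auto simp: linear_iff algebra_simps)
    show "l' x \<le> h x" if x: "x \<in> span (insert v K)" for x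
    proof -
      obtain k where k: "x - k *\<^sub>R v \<in> span K"
        using span_breakdown[of v "insert v K" x] x v by auto
      define w where "w = x - k *\<^sub>R v"
      have x: "x = w + k *\<^sub>R v" and w: "w \<in> span K" using k by (auto simp: w_def)
      have eq: "l' x = l w + k * c"
        unfolding l'_def x using g(2) g0[OF w]
        by (simp add: linear_add[OF l] linear_scale[OF l] linear_add[OF g(1)] linear_scale[OF g(1)]
            algebra_simps)
      \<comment> \<open>The sign of the \<open>v\<close>-coefficient decides which slope bound on
        \<open>c\<close> is used.\<close>
      consider "k = 0" | "k > 0" | "k < 0" by linarith
      then show ?thesis
      proof cases
        case 1 then show ?thesis using le[OF w] eq x by simp
      next
        case 2 then show ?thesis using upper[OF 2 w] eq x by (simp add: field_simps)
      next
        case 3 then show ?thesis using lower[of "- k" w] w eq x by (simp add: field_simps)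
      qed
    qed
  qed
qed

text \<open>Start from the zero functional on the trivial subspace, where domination is just
  \<open>0 \<le> h 0\<close>, and add the vectors of a finite basis one at a time.\<close>

lemma convex_dominates_linear:
  fixes h :: "'v::real_vector \<Rightarrow> real"
  assumes fin: "\<exists>S::'v set. finite S \<and> span S = UNIV" and h: "convex_on UNIV h" and "0 \<le> h 0"
  obtains l where "linear l" "\<And>x. l x \<le> h x"
proof -
  have ext: "\<exists>l. linear l \<and> (\<forall>x\<in>span K. l x \<le> h x)" if "finite K" "independent K" for K :: "'v set"
    using that
  proof (induction K rule: finite_induct)
    case empty
    then show ?case using assms(3) by (intro exI[of _ "\<lambda>_. 0"]) (auto simp: linear_iff)
  next
    case (insert v K)
    then obtain l where l: "linear l" "\<And>x. x \<in> span K \<Longrightarrow> l x \<le> h x"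
      by (meson independent_mono subset_insertI)
    show ?case
      by (rule convex_dominated_extension_step[OF h l insert.prems insert.hyps(2)]) blast+
  qed
  obtain S :: "'v set" where S: "finite S" "span S = UNIV" using fin by blast
  obtain K where K: "K \<subseteq> S" "independent K" "S \<subseteq> span K"
    using maximal_independent_subset by blast
  then have "span K = UNIV" using S(2) span_minimal[OF K(3)] by auto
  moreover have "finite K" using K(1) S(1) finite_subset by blast
  ultimately show ?thesis using ext[of K] K(2) that by auto
qed

text \<open>Translating by \<open>z\<close> and subtracting \<open>h z\<close> gives a convex
  function vanishing at 0, which dominates a linear functional. Continuity of \<open>h\<close> at
  \<open>z\<close> makes that functional bounded, hence an element of the dual.\<close>

lemma convex_continuous_subgradient:
  fixes h :: "'v::real_normed_vector \<Rightarrow> real"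
  assumes fin: "\<exists>S::'v set. finite S \<and> span S = UNIV"
    and h: "convex_on UNIV h" "continuous_on UNIV h"
  obtains y :: "'v \<Rightarrow>\<^sub>L real" where "\<And>w. h z + blinfun_apply y (w - z) \<le> h w"
proof -
  have "convex_on UNIV (\<lambda>w. h (z + w) - h z)"
  proof
    fix t x y assume t: "0 < (t::real)" "t < 1"
    have "h (z + ((1 - t) *\<^sub>R x + t *\<^sub>R y)) = h ((1 - t) *\<^sub>R (z + x) + t *\<^sub>R (z + y))"
      by (simp add: algebra_simps)
    also have "\<dots> \<le> (1 - t) * h (z + x) + t * h (z + y)"
      using convex_onD[OF h(1)] t by simp
    finally show "h (z + ((1 - t) *\<^sub>R x + t *\<^sub>R y)) - h z
        \<le> (1 - t) * (h (z + x) - h z) + t * (h (z + y) - h z)"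
      by (simp add: algebra_simps)
  qed simp
  then obtain l where l: "linear l" "\<And>w. l w \<le> h (z + w) - h z"
    using convex_dominates_linear[OF fin, of "\<lambda>w. h (z + w) - h z"] by auto
  obtain d where d: "d > 0" "\<And>w. dist w z < d \<Longrightarrow> dist (h w) (h z) < 1"
    using h(2) unfolding continuous_on_iff by (metis UNIV_I zero_less_one)
  have bound: "l w \<le> 2 / d * norm w" for w
  proof (cases "w = 0")
    case True then show ?thesis using linear_0[OF l(1)] by simp
  next
    case False
    \<comment> \<open>Rescaling to length \<open>d / 2\<close> lands inside the ball where
      \<open>h\<close> grows by less than 1; this is the source of the constant
      \<open>2 / d\<close>.\<close>
    define u where "u = (d / 2 / norm w) *\<^sub>R w"
    have "dist (z + u) z < d" using d(1) False by (simp add: u_def dist_norm)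
    then have "h (z + u) - h z < 1" using d(2) by (force simp: dist_real_def)
    then have "l u < 1" using l(2)[of u] by simp
    then have "d / 2 / norm w * l w < 1" by (simp add: u_def linear_scale[OF l(1)])
    then show ?thesis using d(1) False by (simp add: field_simps)
  qed
  have "bounded_linear l"
  proof (rule bounded_linear_intro)
    show "norm (l x) \<le> norm x * (2 / d)" for x
      using bound[of x] bound[of "- x"] by (auto simp: linear_neg[OF l(1)] mult.commute abs_le_iff)
  qed (auto simp: linear_add[OF l(1)] linear_scale[OF l(1)])
  then show ?thesis
    using that[of "Blinfun l"] l(2)[of "_ - z"] by (simp add: bounded_linear_Blinfun_apply) (smt (verit))
qed

section \<open>Strongly convex minimization, stability of minimizers, differentiability\<close>

text \<open>
  Strong convexity makes minimizing sequences Cauchy, so completeness replaces compactness.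
\<close>

lemma strongly_convex_minimizer:
  fixes q :: "'a::banach \<Rightarrow> real"
  assumes "S \<noteq> {}" and c: "c > 0" and q: "strongly_convex_on c S q"
    and bdd: "\<And>y. y \<in> S \<Longrightarrow> b \<le> q y"
    and closed: "\<And>s y m. (\<And>n. s n \<in> S) \<Longrightarrow> s \<longlonglongrightarrow> y \<Longrightarrow> (\<lambda>n. q (s n)) \<longlonglongrightarrow> m \<Longrightarrow> y \<in> S \<and> q y \<le> m"
  obtains y where "y \<in> S" "\<And>x. x \<in> S \<Longrightarrow> q y + c / 2 * (norm (x - y))\<^sup>2 \<le> q x"
proof -
  define m where "m = Inf (q ` S)"
  have m: "m \<le> q x" if "x \<in> S" for x
    unfolding m_def using bdd that by (intro cINF_lower bdd_belowI[of _ b]) auto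
  have "\<exists>x\<in>S. q x < m + 1 / Suc n" for n
    using cInf_lessD[of "q ` S" "m + 1 / Suc n"] assms(1) by (auto simp: m_def)
  then obtain s where s: "\<And>n. s n \<in> S" "\<And>n. q (s n) < m + 1 / Suc n" by metis
  have cvx: "convex S" using q unfolding strongly_convex_on_def by blast
  have sc: "q (t *\<^sub>R x + (1 - t) *\<^sub>R y)
      \<le> t * q x + (1 - t) * q y - c / 2 * t * (1 - t) * (norm (x - y))\<^sup>2"
    if "x \<in> S" "y \<in> S" "0 \<le> t" "t \<le> 1" for x y t
    using q that unfolding strongly_convex_on_def by auto
  \<comment> \<open>The midpoint of two almost optimal points cannot beat the infimum
    \<open>m\<close>, so the gain from strong convexity at \<open>t = 1/2\<close>, namely
    \<open>c / 8\<close> times the squared distance, is small.\<close>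
  have gap: "c / 8 * (norm (s i - s j))\<^sup>2 \<le> 1 / Suc N" if "i \<ge> N" "j \<ge> N" for i j N
  proof -
    have "(1/2) *\<^sub>R s i + (1 - 1/2) *\<^sub>R s j \<in> S"
      using convexD[OF cvx s(1)[of i] s(1)[of j], of "1/2" "1/2"] by simp
    then have "m \<le> (1/2) * q (s i) + (1/2) * q (s j) - c / 8 * (norm (s i - s j))\<^sup>2"
      using m sc[OF s(1)[of i] s(1)[of j], of "1/2"] by fastforce
    moreover have "1 / Suc i \<le> 1 / Suc N" "1 / Suc j \<le> 1 / Suc N"
      using that by (auto simp: field_simps)
    ultimately show ?thesis using s(2)[of i] s(2)[of j] by linarith
  qed
  have "Cauchy s"
  proof (rule metric_CauchyI)
    fix e :: real assume e: "e > 0"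
    then obtain N where N: "1 / Suc N < c / 8 * e\<^sup>2"
      using nat_approx_posE[of "c / 8 * e\<^sup>2"] c by auto
    have "dist (s i) (s j) < e" if "i \<ge> N" "j \<ge> N" for i j
    proof -
      have "c / 8 * (norm (s i - s j))\<^sup>2 < c / 8 * e\<^sup>2" using gap[OF that] N by linarith
      then have "(norm (s i - s j))\<^sup>2 < e\<^sup>2" using c by simp
      then show ?thesis using e by (simp add: dist_norm power2_less_imp_less)
    qed
    then show "\<exists>M. \<forall>m\<ge>M. \<forall>n\<ge>M. dist (s m) (s n) < e" by blast
  qed
  then obtain y where y: "s \<longlonglongrightarrow> y" using Cauchy_convergent convergent_def by blast
  have "(\<lambda>n. q (s n)) \<longlonglongrightarrow> m"
  proof (rule tendsto_sandwich[OF _ _ tendsto_const[of m]])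
    show "(\<lambda>n. m + 1 / real (Suc n)) \<longlonglongrightarrow> m"
      using tendsto_add[OF tendsto_const[of m] LIMSEQ_inverse_real_of_nat] by (simp add: inverse_eq_divide)
  qed (use s m in \<open>auto intro!: always_eventually less_imp_le simp del: of_nat_Suc\<close>)
  from closed[OF s(1) y this] have yS: "y \<in> S" and "q y \<le> m" by auto
  then have ym: "q y \<le> q x" if "x \<in> S" for x using m[OF that] by linarith
  have "q y + c / 2 * (norm (x - y))\<^sup>2 \<le> q x" if x: "x \<in> S" for x
  proof -
    have "c / 2 * (norm (x - y))\<^sup>2 \<le> q x - q y"
    \<comment> \<open>Compare \<open>y\<close> with the point of the segment having weight
      \<open>1 - r\<close> on \<open>x\<close>, cancel the factor \<open>1 - r\<close>, and let
      \<open>r\<close> tend to 1.\<close>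
    proof (rule field_le_mult_one_interval)
      fix r :: real assume r: "0 < r" "r < 1"
      have "(1 - r) *\<^sub>R x + (1 - (1 - r)) *\<^sub>R y \<in> S"
        using convexD[OF cvx x yS, of "1 - r" r] r by simp
      then have "0 \<le> (1 - r) * (q x - q y) - (1 - r) * (r * (c / 2 * (norm (x - y))\<^sup>2))"
        using ym sc[OF x yS, of "1 - r"] r by (fastforce simp: algebra_simps)
      then have "0 \<le> (1 - r) * (q x - q y - r * (c / 2 * (norm (x - y))\<^sup>2))"
        by (simp only: right_diff_distrib)
      then show "r * (c / 2 * (norm (x - y))\<^sup>2) \<le> q x - q y"
        using r by (simp add: zero_le_mult_iff)
    qed
    then show ?thesis by simp
  qed
  then show ?thesis using that yS by blast
qed

text \<open>Adding the growth inequality at \<open>z\<close> tested with \<open>Y w\<close> to the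
  one at \<open>w\<close> tested with \<open>Y z\<close> eliminates \<open>q\<close> and leaves
  strong monotonicity of \<open>Y\<close>; the dual norm inequality finishes.\<close>

lemma maximizer_lipschitz:
  fixes Y :: "'v::real_normed_vector \<Rightarrow> 'v \<Rightarrow>\<^sub>L real"
  assumes c: "c > 0" and Y: "\<And>z. Y z \<in> S"
    and growth: "\<And>y z. y \<in> S \<Longrightarrow> q (Y z) - blinfun_apply (Y z) z + c / 2 * (norm (y - Y z))\<^sup>2 \<le> q y - blinfun_apply y z"
  shows "norm (Y w - Y z) \<le> norm (w - z) / c"
proof -
  have "c * (norm (Y w - Y z))\<^sup>2 \<le> blinfun_apply (Y w - Y z) (w - z)"
    using growth[OF Y[of w], of z] growth[OF Y[of z], of w]
    by (simp add: norm_minus_commute[of "Y z"] blinfun.diff_left blinfun.diff_right)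
  also have "\<dots> \<le> norm (Y w - Y z) * norm (w - z)"
    using norm_blinfun[of "Y w - Y z" "w - z"] by simp
  finally have "norm (Y w - Y z) * (c * norm (Y w - Y z)) \<le> norm (Y w - Y z) * norm (w - z)"
    by (simp add: power2_eq_square mult.left_commute)
  then have "c * norm (Y w - Y z) \<le> norm (w - z)"
    by (cases "Y w = Y z") auto
  then show ?thesis using c by (simp add: field_simps)
qed

text \<open>The subgradient inequality at \<open>z\<close> makes the first-order remainder
  nonnegative; the one at \<open>w\<close> bounds it by the pairing of \<open>Y w - Y z\<close> with
  \<open>w - z\<close>, which is of second order.\<close>

lemma has_derivative_lipschitz_subgradient:
  fixes Y :: "'v::real_normed_vector \<Rightarrow> 'v \<Rightarrow>\<^sub>L real"
  assumes sub: "\<And>z w. H z + blinfun_apply (Y z) (w - z) \<le> H w"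
    and lip: "\<And>z w. norm (Y w - Y z) \<le> K * norm (w - z)"
  shows "(H has_derivative blinfun_apply (Y z)) (at z)"
proof (rule has_derivativeI_sandwich[of 1])
  fix w assume "w \<noteq> z"
  have "H w - H z - blinfun_apply (Y z) (w - z) \<le> blinfun_apply (Y w - Y z) (w - z)"
    using sub[of w z] by (simp add: blinfun.diff_left blinfun.diff_right)
  also have "\<dots> \<le> norm (Y w - Y z) * norm (w - z)"
    using norm_blinfun[of "Y w - Y z" "w - z"] by simp
  also have "\<dots> \<le> K * norm (w - z) * norm (w - z)"
    using lip by (intro mult_right_mono) auto
  finally show "norm (H w - H z - blinfun_apply (Y z) (w - z)) / norm (w - z) \<le> K * norm (w - z)"
    using sub[of z w] \<open>w \<noteq> z\<close> by (simp add: divide_le_eq)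
next
  show "((\<lambda>w. K * norm (w - z)) \<longlongrightarrow> 0) (at z)"
    by (rule tendsto_eq_intros refl | simp)+
qed (auto intro: blinfun.bounded_linear_right)

section \<open>Weak convexity of compositions with a map with Lipschitz Jacobian\<close>

lemma linearization_error_le:
  fixes A :: "'e::real_normed_vector \<Rightarrow> 'v::real_normed_vector"
  assumes X: "convex X" and A: "\<And>x. (A has_derivative blinfun_apply (A' x)) (at x)"
    and lip: "L-lipschitz_on X A'" and x: "x \<in> X" and u: "u \<in> X"
  shows "blinfun_apply y (A u - A x - blinfun_apply (A' x) (u - x)) \<le> norm y * L / 2 * (norm (u - x))\<^sup>2"
proof -
  define d where "d = u - x"
  \<comment> \<open>\<open>p\<close> follows the error along the segment minus its claimed quadratic
    majorant, so the claim becomes \<open>p 1 \<le> p 0\<close>. Convexity of \<open>X\<close> keeps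
    the segment where the Lipschitz bound holds.\<close>
  define p where "p s = blinfun_apply y (A (x + s *\<^sub>R d)) - s * blinfun_apply y (blinfun_apply (A' x) d)
    - norm y * L / 2 * (norm d)\<^sup>2 * s\<^sup>2" for s :: real
  have "p 1 \<le> p 0"
  proof (rule DERIV_nonpos_imp_nonincreasing[of 0 1 p])
    fix s :: real assume s: "0 \<le> s" "s \<le> 1"
    let ?D = "blinfun_apply y (blinfun_apply (A' (x + s *\<^sub>R d) - A' x) d) - norm y * L * (norm d)\<^sup>2 * s"
    have "((\<lambda>s. blinfun_apply y (A (x + s *\<^sub>R d))) has_derivative
        (\<lambda>r. blinfun_apply y (blinfun_apply (A' (x + s *\<^sub>R d)) (r *\<^sub>R d)))) (at s)"
      by (rule bounded_linear.has_derivative[OF blinfun.bounded_linear_right],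
          rule has_derivative_compose[OF _ A]) (auto intro!: derivative_eq_intros)
    then have "((\<lambda>s. blinfun_apply y (A (x + s *\<^sub>R d))) has_real_derivative
        blinfun_apply y (blinfun_apply (A' (x + s *\<^sub>R d)) d)) (at s)"
      by (rule has_derivative_imp_has_field_derivative) (simp add: blinfun.scaleR_right)
    then have "(p has_real_derivative ?D) (at s)"
      unfolding p_def by (auto intro!: derivative_eq_intros simp: blinfun.diff_left blinfun.diff_right)
    moreover have "?D \<le> 0"
    proof -
      have "x + s *\<^sub>R d = (1 - s) *\<^sub>R x + s *\<^sub>R u" by (simp add: d_def algebra_simps)
      then have "x + s *\<^sub>R d \<in> X" using convexD[OF X x u, of "1 - s" s] s by simp
      then have "norm (A' (x + s *\<^sub>R d) - A' x) \<le> L * (s * norm d)"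
        using lipschitz_onD[OF lip _ x] s by (fastforce simp: dist_norm)
      then have "norm y * (norm (A' (x + s *\<^sub>R d) - A' x) * norm d) \<le> norm y * (L * (s * norm d) * norm d)"
        by (intro mult_left_mono mult_right_mono) auto
      moreover have "blinfun_apply y (blinfun_apply (A' (x + s *\<^sub>R d) - A' x) d)
          \<le> norm y * norm (blinfun_apply (A' (x + s *\<^sub>R d) - A' x) d)"
        using norm_blinfun[of y "blinfun_apply (A' (x + s *\<^sub>R d) - A' x) d"] by simp
      moreover have "\<dots> \<le> norm y * (norm (A' (x + s *\<^sub>R d) - A' x) * norm d)"
        by (intro mult_left_mono norm_blinfun) auto
      ultimately show ?thesis by (simp add: power2_eq_square algebra_simps)
    qed
    ultimately show "\<exists>D. (p has_real_derivative D) (at s) \<and> D \<le> 0" by blast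
  qed simp
  then show ?thesis by (simp add: p_def d_def blinfun.diff_right)
qed

text \<open>The exact convexity gap of the Euclidean norm squared, which will absorb the quadratic
  loss caused by linearizing \<open>A\<close>.\<close>

lemma norm_convex_combination:
  fixes x y :: "'a::real_inner"
  shows "(norm ((1 - t) *\<^sub>R x + t *\<^sub>R y))\<^sup>2
    = (1 - t) * (norm x)\<^sup>2 + t * (norm y)\<^sup>2 - t * (1 - t) * (norm (x - y))\<^sup>2"
  unfolding power2_norm_eq_inner
  by (simp add: inner_add_left inner_add_right inner_diff_left inner_diff_right inner_commute[of y x]
      algebra_simps power2_eq_square)

text \<open>A subgradient of \<open>H\<close> at \<open>A x\<close> and the linearization bound give
  a quadratic model of the composite that lies below it and touches it at \<open>x\<close>.
  Averaging the model over two points with convex combination \<open>x\<close> removes the linear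
  part.\<close>

lemma weakly_convex_on_compose:
  fixes A :: "'e::real_inner \<Rightarrow> 'v::real_normed_vector"
  assumes X: "convex X" and A: "\<And>x. (A has_derivative blinfun_apply (A' x)) (at x)"
    and lip: "L-lipschitz_on X A'"
    and sub: "\<And>z. \<exists>y. norm y \<le> B \<and> (\<forall>w. H z + blinfun_apply y (w - z) \<le> H w)"
  shows "weakly_convex_on (B * L) X (\<lambda>x. H (A x))"
  unfolding weakly_convex_on_def
proof (rule convex_onI[OF _ X])
  fix t :: real and x1 x2 assume t: "0 < t" "t < 1" and x12: "x1 \<in> X" "x2 \<in> X"
  define x where "x = (1 - t) *\<^sub>R x1 + t *\<^sub>R x2"
  have x: "x \<in> X" using convexD[OF X x12, of "1 - t" t] t by (simp add: x_def)
  obtain y where y: "norm y \<le> B" "\<And>w. H (A x) + blinfun_apply y (w - A x) \<le> H w"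
    using sub by blast
  have lower: "H (A x) + blinfun_apply y (blinfun_apply (A' x) (u - x)) - B * L / 2 * (norm (u - x))\<^sup>2 \<le> H (A u)"
    if "u \<in> X" for u
  proof -
    \<comment> \<open>The error bound is one-sided, so the required lower estimate comes from
      applying it to \<open>- y\<close>.\<close>
    have "blinfun_apply (- y) (A u - A x - blinfun_apply (A' x) (u - x)) \<le> norm y * L / 2 * (norm (u - x))\<^sup>2"
      using linearization_error_le[OF X A lip x that, of "- y"] by simp
    also have "\<dots> \<le> B * L / 2 * (norm (u - x))\<^sup>2"
      using y(1) lipschitz_on_nonneg[OF lip] by (intro mult_right_mono divide_right_mono) auto
    finally show ?thesis using y(2)[of "A u"] by (simp add: blinfun.minus_left blinfun.diff_right)
  qed
  \<comment> \<open>The displacements are opposite multiples of one vector, so the first-order terms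
    cancel under the weights \<open>1 - t\<close> and \<open>t\<close>.\<close>
  have d1: "x1 - x = t *\<^sub>R (x1 - x2)" and d2: "x2 - x = - ((1 - t) *\<^sub>R (x1 - x2))"
    by (simp_all add: x_def algebra_simps)
  have "(1 - t) * (H (A x) + t * blinfun_apply y (blinfun_apply (A' x) (x1 - x2)) - B * L / 2 * (t * norm (x1 - x2))\<^sup>2)
      \<le> (1 - t) * H (A x1)"
    using lower[OF x12(1)] t unfolding d1 by (intro mult_left_mono) (auto simp: blinfun.scaleR_right)
  moreover have "t * (H (A x) - (1 - t) * blinfun_apply y (blinfun_apply (A' x) (x1 - x2)) - B * L / 2 * ((1 - t) * norm (x1 - x2))\<^sup>2)
      \<le> t * H (A x2)"
    using lower[OF x12(2)] t unfolding d2
    by (intro mult_left_mono) (auto simp: blinfun.scaleR_right blinfun.minus_right)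
  ultimately have "H (A x) - B * L / 2 * (t * (1 - t) * (norm (x1 - x2))\<^sup>2) \<le> (1 - t) * H (A x1) + t * H (A x2)"
    by (simp add: algebra_simps power2_eq_square add_divide_distrib diff_divide_distrib)
  then show "H (A ((1 - t) *\<^sub>R x1 + t *\<^sub>R x2)) + B * L / 2 * (norm ((1 - t) *\<^sub>R x1 + t *\<^sub>R x2))\<^sup>2
      \<le> (1 - t) * (H (A x1) + B * L / 2 * (norm x1)\<^sup>2) + t * (H (A x2) + B * L / 2 * (norm x2)\<^sup>2)"
    unfolding norm_convex_combination[of t x1 x2, folded x_def] x_def[symmetric]
    by (simp add: algebra_simps add_divide_distrib diff_divide_distrib)
qed

section \<open>Gradients, transposes and the gradient Lipschitz estimate\<close>

lemma gradient_eqI: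
  assumes "GDERIV g x :> D"
  shows "gradient g x = D"
  unfolding gradient_def
proof (rule the_equality)
  fix D' assume "GDERIV g x :> D'"
  then have "(\<lambda>h. h \<bullet> D') = (\<lambda>h. h \<bullet> D)"
    using assms unfolding gderiv_def by (rule has_derivative_unique)
  then show "D' = D" by (metis vector_eq_ldot)
qed (fact assms)

lemma blinfun_transpose_diff_left: "blinfun_transpose (S - T) y = blinfun_transpose S y - blinfun_transpose T y"
  by (simp add: blinfun_transpose_def blinfun.diff_left blinfun.diff_right sum_subtractf scaleR_diff_left)

lemma blinfun_transpose_diff_right: "blinfun_transpose T (y - y') = blinfun_transpose T y - blinfun_transpose T y'"
  by (simp add: blinfun_transpose_def blinfun.diff_left sum_subtractf scaleR_diff_left)

text \<open>Pairing the transposed vector with itself turns its squared norm into \<open>y\<close>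
  applied to an image of \<open>T\<close>; one factor of the norm then cancels.\<close>

lemma norm_blinfun_transpose_le: "norm (blinfun_transpose T y) \<le> norm T * norm y"
proof -
  let ?v = "blinfun_transpose T y"
  have "norm ?v * norm ?v = blinfun_apply y (blinfun_apply T ?v)"
    unfolding inner_blinfun_transpose[symmetric] by (simp add: norm_eq_sqrt_inner)
  also have "\<dots> \<le> norm y * norm (blinfun_apply T ?v)"
    using norm_blinfun[of y "blinfun_apply T ?v"] by simp
  also have "\<dots> \<le> norm y * (norm T * norm ?v)"
    by (intro mult_left_mono norm_blinfun) auto
  finally show ?thesis by (cases "?v = 0") (auto simp: mult.commute mult.assoc)
qed

text \<open>A supremum in the reals is an upper bound only for a family bounded above; compactness
  of the segment and continuity of \<open>A'\<close> provide this.\<close>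

lemma norm_on_segment_le_SUP:
  fixes A' :: "'e::real_normed_vector \<Rightarrow> 'b::real_normed_vector"
  assumes "continuous_on UNIV A'" "\<theta> \<in> {0..1}"
  shows "(norm (A' (\<theta> *\<^sub>R x1 + (1 - \<theta>) *\<^sub>R x2)))\<^sup>2
    \<le> (SUP \<theta>\<in>{0..1::real}. (norm (A' (\<theta> *\<^sub>R x1 + (1 - \<theta>) *\<^sub>R x2)))\<^sup>2)"
proof (rule cSUP_upper[OF assms(2)])
  have "continuous_on {0..1} (\<lambda>\<theta>. (norm (A' (\<theta> *\<^sub>R x1 + (1 - \<theta>) *\<^sub>R x2)))\<^sup>2)"
    by (intro continuous_intros continuous_on_compose2[OF assms(1)]) auto
  then show "bdd_above ((\<lambda>\<theta>. (norm (A' (\<theta> *\<^sub>R x1 + (1 - \<theta>) *\<^sub>R x2)))\<^sup>2) ` {0..1})"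
    by (intro bounded_imp_bdd_above compact_imp_bounded compact_continuous_image) auto
qed

text \<open>The change splits into that of the Jacobian, costing \<open>B * L\<close>, and that of
  \<open>Y\<close>. The latter collects \<open>sqrt M\<close> twice: from the Jacobian at
  \<open>x2\<close> and from the mean value bound for \<open>A\<close>.\<close>

lemma blinfun_transpose_lipschitz:
  fixes A :: "'e::euclidean_space \<Rightarrow> 'v::real_normed_vector"
  assumes A: "\<And>x. (A has_derivative blinfun_apply (A' x)) (at x)" and cont: "continuous_on UNIV A'"
    and lip: "L-lipschitz_on X A'" and x: "x1 \<in> X" "x2 \<in> X" and K: "K \<ge> 0"
    and Y: "\<And>z. norm (Y z) \<le> B" "\<And>w z. norm (Y w - Y z) \<le> K * norm (w - z)"
  shows "norm (blinfun_transpose (A' x1) (Y (A x1)) - blinfun_transpose (A' x2) (Y (A x2)))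
    \<le> (K * (SUP \<theta>\<in>{0..1}. (norm (A' (\<theta> *\<^sub>R x1 + (1 - \<theta>) *\<^sub>R x2)))\<^sup>2) + B * L) * norm (x1 - x2)"
proof -
  define M where "M = (SUP \<theta>\<in>{0..1::real}. (norm (A' (\<theta> *\<^sub>R x1 + (1 - \<theta>) *\<^sub>R x2)))\<^sup>2)"
  have M: "norm (A' (\<theta> *\<^sub>R x1 + (1 - \<theta>) *\<^sub>R x2)) \<le> sqrt M" if "\<theta> \<in> {0..1}" for \<theta>
    unfolding M_def by (intro real_le_rsqrt norm_on_segment_le_SUP[OF cont that])
  have M0: "0 \<le> M" unfolding M_def
    by (rule order_trans[OF zero_le_power2 norm_on_segment_le_SUP[OF cont, of 0]]) simp
  have "norm (A (x2 + (x1 - x2)) - A x2) \<le> norm (x1 - x2) * sqrt M"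
  proof (rule differentiable_bound_segment[where G = UNIV])
    show "onorm (blinfun_apply (A' (x2 + \<theta> *\<^sub>R (x1 - x2)))) \<le> sqrt M" if "\<theta> \<in> {0..1}" for \<theta>
      using M[OF that] by (simp add: norm_blinfun.rep_eq algebra_simps)
  qed (auto intro: A)
  then have AM: "norm (A x1 - A x2) \<le> norm (x1 - x2) * sqrt M" by simp
  have "blinfun_transpose (A' x1) (Y (A x1)) - blinfun_transpose (A' x2) (Y (A x2))
      = blinfun_transpose (A' x1 - A' x2) (Y (A x1)) + blinfun_transpose (A' x2) (Y (A x1) - Y (A x2))"
    by (simp add: blinfun_transpose_diff_left blinfun_transpose_diff_right)
  also have "norm \<dots> \<le> norm (A' x1 - A' x2) * norm (Y (A x1)) + norm (A' x2) * norm (Y (A x1) - Y (A x2))"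
    by (rule norm_triangle_le[OF add_mono]) (rule norm_blinfun_transpose_le)+
  also have "norm (A' x1 - A' x2) * norm (Y (A x1)) \<le> (L * norm (x1 - x2)) * B"
    using lipschitz_onD[OF lip x] Y(1) lipschitz_on_nonneg[OF lip]
    by (intro mult_mono) (auto simp: dist_norm)
  also have "norm (A' x2) * norm (Y (A x1) - Y (A x2)) \<le> sqrt M * (K * (norm (x1 - x2) * sqrt M))"
  proof (rule mult_mono)
    show "norm (A' x2) \<le> sqrt M" using M[of 0] by simp
    show "norm (Y (A x1) - Y (A x2)) \<le> K * (norm (x1 - x2) * sqrt M)"
      using Y(2) AM K by (meson mult_left_mono order_trans)
  qed (use M0 in auto)
  also have "\<dots> = K * M * norm (x1 - x2)" using M0 by (simp add: algebra_simps flip: power2_eq_square)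
  finally show ?thesis unfolding M_def by (simp add: algebra_simps)
qed

section \<open>The conjugate and the regularized dual objective\<close>

text \<open>The term at \<open>z = 0\<close> keeps the conjugate above \<open>-\<infinity>\<close>,
  so on its domain real arithmetic is available.\<close>

lemma conjugate_edom:
  assumes "y \<in> edom (conjugate h)"
  shows "conjugate h y = ereal (real_of_ereal (conjugate h y))"
proof -
  have "ereal (blinfun_apply y 0 - h 0) \<le> conjugate h y"
    unfolding conjugate_def by (rule SUP_upper) simp
  then show ?thesis using assms by (cases "conjugate h y") (auto simp: edom_def)
qed

lemma fenchel_young:
  assumes "y \<in> edom (conjugate h)"
  shows "blinfun_apply y z - h z \<le> real_of_ereal (conjugate h y)"
proof -
  have "ereal (blinfun_apply y z - h z) \<le> conjugate h y"
    unfolding conjugate_def by (rule SUP_upper) simp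
  then show ?thesis by (subst (asm) conjugate_edom[OF assms]) simp
qed

lemma conjugate_leI:
  assumes "\<And>z. blinfun_apply y z - h z \<le> r"
  shows "y \<in> edom (conjugate h)" "real_of_ereal (conjugate h y) \<le> r"
proof -
  have le: "conjugate h y \<le> ereal r"
    unfolding conjugate_def by (rule SUP_least) (simp add: assms)
  then show y: "y \<in> edom (conjugate h)" by (auto simp: edom_def intro: le_less_trans)
  show "real_of_ereal (conjugate h y) \<le> r"
    using le by (subst (asm) conjugate_edom[OF y]) simp
qed

lemma prox_function_real:
  assumes "prox_function \<sigma> S \<omega>" "y \<in> S"
  shows "\<omega> y = ereal (real_of_ereal (\<omega> y))" "0 \<le> real_of_ereal (\<omega> y)"
  using assms unfolding prox_function_def by (auto simp: ereal_real real_of_ereal_pos)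

lemma smoothing_objective_real:
  assumes "prox_function \<sigma> (edom (conjugate h)) \<omega>" "y \<in> edom (conjugate h)"
  shows "smoothing_objective h \<omega> \<eta> z y
    = ereal (blinfun_apply y z - real_of_ereal (conjugate h y) - \<eta> * real_of_ereal (\<omega> y))"
  unfolding smoothing_objective_def
  by (subst conjugate_edom[OF assms(2)], subst prox_function_real(1)[OF assms]) simp

text \<open>This confines the maximization over the whole dual to the domain of the
  conjugate.\<close>

lemma smoothing_objective_outside:
  assumes "prox_function \<sigma> (edom (conjugate h)) \<omega>" "y \<notin> edom (conjugate h)" "\<eta> > 0"
  shows "smoothing_objective h \<omega> \<eta> z y = - \<infinity>"
proof -
  have "conjugate h y = \<infinity>" using assms(2) by (simp add: edom_def)
  moreover have "0 \<le> \<omega> y" using assms(1) by (simp add: prox_function_def)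
  ultimately show ?thesis using assms(3)
    by (cases "\<omega> y") (auto simp: smoothing_objective_def)
qed

text \<open>The conjugate is convex as a supremum of functions affine in \<open>y\<close>, the
  pairing with \<open>z\<close> is linear, and all strong convexity comes from
  \<open>\<eta> * g\<close>.\<close>

lemma strongly_convex_on_smoothing:
  assumes "strongly_convex_on \<sigma> (edom (conjugate h)) g" and "\<eta> \<ge> 0"
  shows "strongly_convex_on (\<eta> * \<sigma>) (edom (conjugate h))
    (\<lambda>y. real_of_ereal (conjugate h y) + \<eta> * g y - blinfun_apply y z)"
  unfolding strongly_convex_on_def
proof (intro conjI ballI)
  show S: "convex (edom (conjugate h))" using assms(1) by (simp add: strongly_convex_on_def)
  fix x y :: "'a \<Rightarrow>\<^sub>L real" and t :: real
  assume x: "x \<in> edom (conjugate h)" and y: "y \<in> edom (conjugate h)" and t: "t \<in> {0..1}"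
  let ?u = "t *\<^sub>R x + (1 - t) *\<^sub>R y" and ?p = "\<lambda>y. real_of_ereal (conjugate h y)"
  have "blinfun_apply ?u z - h z \<le> t * ?p x + (1 - t) * ?p y" for z
  proof -
    have "t * (blinfun_apply x z - h z) + (1 - t) * (blinfun_apply y z - h z) \<le> t * ?p x + (1 - t) * ?p y"
      using t by (intro add_mono mult_left_mono fenchel_young x y) auto
    then show ?thesis
      by (simp add: blinfun.add_left blinfun.diff_left blinfun.scaleR_left algebra_simps)
  qed
  then have "?p ?u \<le> t * ?p x + (1 - t) * ?p y" by (rule conjugate_leI)
  moreover have "\<eta> * g ?u \<le> \<eta> * (t * g x + (1 - t) * g y - \<sigma> / 2 * t * (1 - t) * (norm (x - y))\<^sup>2)"
    using assms x y t unfolding strongly_convex_on_def by (intro mult_left_mono) auto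
  ultimately show "?p ?u + \<eta> * g ?u - blinfun_apply ?u z
      \<le> t * (?p x + \<eta> * g x - blinfun_apply x z) + (1 - t) * (?p y + \<eta> * g y - blinfun_apply y z)
        - \<eta> * \<sigma> / 2 * t * (1 - t) * (norm (x - y))\<^sup>2"
    by (simp add: blinfun.add_left blinfun.diff_left blinfun.scaleR_left algebra_simps)
qed

text \<open>The limit inferior ignores the point \<open>y\<close> itself; the assumption
  \<open>r < g y\<close> covers it, so the sequence may hit its limit.\<close>

lemma lower_semicontinuous_sequentially:
  assumes "lower_semicontinuous g" "s \<longlonglongrightarrow> y" "r < g y"
  shows "\<forall>\<^sub>F n in sequentially. r < g (s n)"
proof -
  have "\<forall>\<^sub>F x in at y. r < g x"
    using assms(1,3) unfolding lower_semicontinuous_def le_Liminf_iff by blast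
  then have "\<forall>\<^sub>F x in nhds y. r < g x"
    using assms(3) unfolding eventually_at_filter by (auto elim: eventually_mono)
  then show ?thesis using assms(2) by (rule eventually_compose_filterlim)
qed

text \<open>Existence and growth come from the strongly convex minimizer lemma. The work lies in its
  closedness condition: a limit of domain points must be shown to be a domain point again.\<close>

lemma smoothing_growth:
  fixes h :: "'v::real_normed_vector \<Rightarrow> real" and z :: 'v
  defines "q \<equiv> \<lambda>\<omega> \<eta> y. real_of_ereal (conjugate h y) + \<eta> * real_of_ereal (\<omega> y)"
  assumes ne: "edom (conjugate h) \<noteq> {}" and \<omega>: "prox_function \<sigma> (edom (conjugate h)) \<omega>"
    and "\<sigma> > 0" and \<eta>: "\<eta> > 0"
  shows "\<exists>y. y \<in> edom (conjugate h) \<and> (\<forall>x\<in>edom (conjugate h).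
      q \<omega> \<eta> y - blinfun_apply y z + \<eta> * \<sigma> / 2 * (norm (x - y))\<^sup>2 \<le> q \<omega> \<eta> x - blinfun_apply x z)"
proof (rule strongly_convex_minimizer[OF ne])
  show "0 < \<eta> * \<sigma>" using assms by simp
  show "strongly_convex_on (\<eta> * \<sigma>) (edom (conjugate h)) (\<lambda>y. q \<omega> \<eta> y - blinfun_apply y z)"
    unfolding q_def using \<omega> \<eta> by (intro strongly_convex_on_smoothing) (auto simp: prox_function_def)
  show "- h z \<le> q \<omega> \<eta> y - blinfun_apply y z" if "y \<in> edom (conjugate h)" for y
    using fenchel_young[OF that, of z]
      mult_nonneg_nonneg[OF less_imp_le[OF \<eta>] prox_function_real(2)[OF \<omega> that]]
    unfolding q_def by linarith
next
  fix s y m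
  assume s: "\<And>n. s n \<in> edom (conjugate h)" "s \<longlonglongrightarrow> y"
    and m: "(\<lambda>n. q \<omega> \<eta> (s n) - blinfun_apply (s n) z) \<longlonglongrightarrow> m"
  have lsc: "lower_semicontinuous \<omega>" and pos: "0 \<le> \<omega> y"
    using \<omega> by (auto simp: prox_function_def)
  \<comment> \<open>Pass to the limit in Fenchel-Young along the sequence. Lower semicontinuity lets
    \<open>r\<close> replace the values of \<open>\<omega>\<close>, and the bound is uniform in
    \<open>u\<close>, hence one on the conjugate at \<open>y\<close>.\<close>
  have bound: "blinfun_apply y u - h u \<le> m + blinfun_apply y z - \<eta> * r" if r: "ereal r < \<omega> y" for u r
  proof -
    have "(\<lambda>n. blinfun_apply (s n) u - h u) \<longlonglongrightarrow> blinfun_apply y u - h u"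
      by (intro tendsto_intros s(2))
    moreover have "(\<lambda>n. (q \<omega> \<eta> (s n) - blinfun_apply (s n) z) + blinfun_apply (s n) z - \<eta> * r)
        \<longlonglongrightarrow> m + blinfun_apply y z - \<eta> * r"
      by (intro tendsto_intros s(2) m)
    moreover have "\<forall>\<^sub>F n in sequentially. blinfun_apply (s n) u - h u
        \<le> (q \<omega> \<eta> (s n) - blinfun_apply (s n) z) + blinfun_apply (s n) z - \<eta> * r"
      using lower_semicontinuous_sequentially[OF lsc s(2) r]
    proof eventually_elim
      case (elim n)
      then have "r \<le> real_of_ereal (\<omega> (s n))"
        by (subst (asm) prox_function_real(1)[OF \<omega> s(1)]) simp
      then have "\<eta> * r \<le> \<eta> * real_of_ereal (\<omega> (s n))" using \<eta> by simp
      then show ?case using fenchel_young[OF s(1), of n u] by (simp add: q_def)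
    qed
    ultimately show ?thesis by (intro tendsto_le[OF sequentially_bot])
  qed
  \<comment> \<open>Any real strictly below \<open>\<omega> y\<close> would do; at this stage only
    finiteness of the conjugate at \<open>y\<close> is extracted.\<close>
  have "ereal (- 1) < \<omega> y" using pos by (rule less_le_trans[rotated]) simp
  from conjugate_leI(1)[OF bound[OF this]] have y: "y \<in> edom (conjugate h)" .
  have "real_of_ereal (\<omega> y) \<le> (m + blinfun_apply y z - real_of_ereal (conjugate h y)) / \<eta>"
  \<comment> \<open>With \<open>y\<close> in the domain, \<open>\<omega> y\<close> is real, and
    \<open>r\<close> can increase to it.\<close>
  proof (rule dense_le)
    fix r assume "r < real_of_ereal (\<omega> y)"
    then have "ereal r < \<omega> y" by (subst prox_function_real(1)[OF \<omega> y]) simp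
    from conjugate_leI(2)[OF bound[OF this]]
    show "r \<le> (m + blinfun_apply y z - real_of_ereal (conjugate h y)) / \<eta>"
      using \<eta> by (simp add: field_simps)
  qed
  then have "q \<omega> \<eta> y - blinfun_apply y z \<le> m" using \<eta> by (simp add: q_def field_simps)
  with y show "y \<in> edom (conjugate h) \<and> q \<omega> \<eta> y - blinfun_apply y z \<le> m" by blast
qed blast

section \<open>Smoothing of the composite function\<close>

theorem theorem4p1:
  fixes X :: "'e::euclidean_space set"
    and A :: "'e \<Rightarrow> 'v::real_normed_vector"
    and A' :: "'e \<Rightarrow> 'e \<Rightarrow>\<^sub>L 'v"
    and h :: "'v \<Rightarrow> real"
    and \<omega> :: "('v \<Rightarrow>\<^sub>L real) \<Rightarrow> ereal"
    and yopt :: "'v \<Rightarrow> 'v \<Rightarrow>\<^sub>L real"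
    and f f\<eta> R\<eta> :: "'e \<Rightarrow> real"
    and L\<eta> :: "'e \<Rightarrow> 'e \<Rightarrow> real"
    and LA \<sigma> \<eta> B D :: real
  assumes finite_dim: "\<exists>S::'v set. finite S \<and> span S = UNIV"
    and X: "closed X" "convex X"
    and A_deriv: "\<And>x. (A has_derivative blinfun_apply (A' x)) (at x)"
    and A'_cont: "continuous_on UNIV A'"
    and A'_lipschitz: "LA-lipschitz_on X A'"
    and h: "convex_on UNIV h" "continuous_on UNIV h"
    and dom_bounded: "bounded (edom (conjugate h))"
    and \<sigma>: "\<sigma> > 0"
    and \<omega>: "prox_function \<sigma> (edom (conjugate h)) \<omega>"
    and B: "B = (SUP y\<in>edom (conjugate h). norm y)"
    and D: "ereal D = (SUP y\<in>edom (conjugate h). \<omega> y)"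
    and \<eta>: "\<eta> > 0"
    and f: "f = (\<lambda>x. h (A x))"
    and f\<eta>: "f\<eta> = (\<lambda>x. real_of_ereal (smoothing h \<omega> \<eta> (A x)))"
    and yopt: "yopt = (\<lambda>z. arg_max (smoothing_objective h \<omega> \<eta> z) (\<lambda>_. True))"
    and R\<eta>: "R\<eta> = (\<lambda>x. \<eta> * D)"
    and L\<eta>: "L\<eta> = (\<lambda>x1 x2.
          1 / (\<sigma> * \<eta>) * (SUP \<theta>\<in>{0..1}. (norm (A' (\<theta> *\<^sub>R x1 + (1 - \<theta>) *\<^sub>R x2)))\<^sup>2) + B * LA)"
  shows
    "(\<forall>z. \<bar>smoothing h \<omega> \<eta> z\<bar> \<noteq> \<infinity>) \<and>
     (\<forall>x. f\<eta> x \<le> f x \<and> f x \<le> f\<eta> x + R\<eta> x) \<and>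
     (\<forall>z. \<exists>!y. is_arg_max (smoothing_objective h \<omega> \<eta> z) (\<lambda>_. True) y) \<and>
     continuously_differentiable_on X f\<eta> \<and>
     (\<forall>x\<in>X. GDERIV f\<eta> x :> blinfun_transpose (A' x) (yopt (A x))) \<and>
     weakly_convex_on (B * LA) X f\<eta> \<and>
     (\<forall>x1\<in>X. \<forall>x2\<in>X.
        norm (gradient f\<eta> x1 - gradient f\<eta> x2) \<le> L\<eta> x1 x2 * norm (x1 - x2)) \<and>
     smooth_approximation X f f\<eta> (B * LA) R\<eta> L\<eta>"
proof -
  let ?S = "edom (conjugate h)"
  define p w where "p = (\<lambda>y. real_of_ereal (conjugate h y))" and "w = (\<lambda>y. real_of_ereal (\<omega> y))"
  have c: "\<eta> * \<sigma> > 0" using \<eta> \<sigma> by simp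
  \<comment> \<open>A subgradient of \<open>h\<close> at \<open>z\<close> attains equality in
    Fenchel-Young. This yields nonemptiness of the domain, the upper approximation bound and the
    weak convexity of \<open>f\<close>.\<close>
  have sub: "\<exists>y\<in>?S. p y \<le> blinfun_apply y z - h z" for z
  proof -
    obtain y :: "'v \<Rightarrow>\<^sub>L real" where y: "\<And>w. h z + blinfun_apply y (w - z) \<le> h w"
      using convex_continuous_subgradient[OF finite_dim h] by blast
    have "blinfun_apply y w - h w \<le> blinfun_apply y z - h z" for w
      using y[of w] by (simp add: blinfun.diff_right)
    then show ?thesis using conjugate_leI unfolding p_def by blast
  qed
  then have ne: "?S \<noteq> {}" by blast
  \<comment> \<open>\<open>B\<close> is a supremum in the reals, so boundedness of the domain is
    what makes it an upper bound.\<close>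
  have "bdd_above (norm ` ?S)"
    using dom_bounded by (auto simp: bounded_iff intro: bdd_aboveI2)
  then have nB: "norm y \<le> B" if "y \<in> ?S" for y
    unfolding B using that by (intro cSUP_upper)
  have B0: "0 \<le> B" using ne nB norm_ge_zero order_trans by blast
  have LA0: "0 \<le> LA" using A'_lipschitz by (rule lipschitz_on_nonneg)
  have w0: "0 \<le> w y" and wD: "w y \<le> D" if "y \<in> ?S" for y
  proof -
    show "0 \<le> w y" unfolding w_def by (rule prox_function_real(2)[OF \<omega> that])
    have "\<omega> y \<le> ereal D" unfolding D by (rule SUP_upper[OF that])
    then show "w y \<le> D" unfolding w_def by (subst (asm) prox_function_real(1)[OF \<omega> that]) simp
  qed
  then have D0: "0 \<le> D" using ne order_trans by blast
  have "\<forall>z. \<exists>y. y \<in> ?S \<and> (\<forall>x\<in>?S. p y + \<eta> * w y - blinfun_apply y z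
      + \<eta> * \<sigma> / 2 * (norm (x - y))\<^sup>2 \<le> p x + \<eta> * w x - blinfun_apply x z)"
    unfolding p_def w_def by (intro allI smoothing_growth[OF ne \<omega> \<sigma> \<eta>])
  from choice[OF this] obtain Y where Y: "\<And>z. Y z \<in> ?S"
    and growth: "\<And>x z. x \<in> ?S \<Longrightarrow> p (Y z) + \<eta> * w (Y z) - blinfun_apply (Y z) z
        + \<eta> * \<sigma> / 2 * (norm (x - Y z))\<^sup>2 \<le> p x + \<eta> * w x - blinfun_apply x z"
    by blast
  have le: "blinfun_apply x z - p x - \<eta> * w x \<le> blinfun_apply (Y z) z - p (Y z) - \<eta> * w (Y z)"
    if "x \<in> ?S" for x z
  proof -
    have "0 \<le> \<eta> * \<sigma> / 2 * (norm (x - Y z))\<^sup>2" using c by simp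
    then show ?thesis using growth[OF that, of z] by linarith
  qed
  define H where "H z = blinfun_apply (Y z) z - p (Y z) - \<eta> * w (Y z)" for z
  have obj_Y: "smoothing_objective h \<omega> \<eta> z (Y z) = ereal (H z)" for z
    by (simp add: smoothing_objective_real[OF \<omega> Y] H_def p_def w_def)
  \<comment> \<open>Quadratic growth is strict away from \<open>Y z\<close>, and off the domain the
    objective is \<open>-\<infinity>\<close>; hence the maximizer is unique.\<close>
  have obj_less: "smoothing_objective h \<omega> \<eta> z x < ereal (H z)" if "x \<noteq> Y z" for x z
  proof (cases "x \<in> ?S")
    case True
    have "0 < \<eta> * \<sigma> / 2 * (norm (x - Y z))\<^sup>2" using c that by simp
    then show ?thesis using growth[OF True, of z]
      by (simp add: smoothing_objective_real[OF \<omega> True] H_def flip: p_def w_def)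
        (simp add: p_def w_def)
  qed (simp add: smoothing_objective_outside[OF \<omega> _ \<eta>])
  have smoothing: "smoothing h \<omega> \<eta> z = ereal (H z)" for z
    unfolding smoothing_def
  proof (rule antisym)
    show "(SUP y. smoothing_objective h \<omega> \<eta> z y) \<le> ereal (H z)"
      using obj_less obj_Y by (intro SUP_least) (metis less_imp_le order_refl)
    show "ereal (H z) \<le> (SUP y. smoothing_objective h \<omega> \<eta> z y)"
      unfolding obj_Y[symmetric] by (rule SUP_upper) simp
  qed
  have arg_max: "is_arg_max (smoothing_objective h \<omega> \<eta> z) (\<lambda>_. True) y \<longleftrightarrow> y = Y z" for y z
    unfolding is_arg_max_def by (metis obj_Y obj_less less_asym less_irrefl)
  have yopt_eq: "yopt z = Y z" for z
    unfolding yopt arg_max_def by (rule some_equality) (simp_all only: arg_max)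
  have f\<eta>_eq: "f\<eta> = (\<lambda>x. H (A x))" by (simp add: f\<eta> smoothing)
  have approx: "f\<eta> x \<le> f x \<and> f x \<le> f\<eta> x + R\<eta> x" for x
  proof
    have "0 \<le> \<eta> * w (Y (A x))" using \<eta> w0[OF Y] by simp
    then show "f\<eta> x \<le> f x"
      using fenchel_young[OF Y[of "A x"], of "A x"] by (simp add: f\<eta>_eq f H_def p_def)
    \<comment> \<open>The dual point attaining \<open>h (A x)\<close> competes in the regularized
      problem and loses at most \<open>\<eta> * D\<close> there.\<close>
    obtain y where y: "y \<in> ?S" "p y \<le> blinfun_apply y (A x) - h (A x)" using sub by blast
    have "\<eta> * w y \<le> \<eta> * D" using wD[OF y(1)] \<eta> by simp
    then show "f x \<le> f\<eta> x + R\<eta> x"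
      using le[OF y(1), of "A x"] y(2) by (simp add: f\<eta>_eq f H_def R\<eta>)
  qed
  \<comment> \<open>\<open>Y z\<close> is a competitor in the problem at \<open>v\<close>, whose
    objective differs from that at \<open>z\<close> only in the linear term.\<close>
  have H_sub: "H z + blinfun_apply (Y z) (v - z) \<le> H v" for z v
    using le[OF Y[of z], of v] by (simp add: H_def blinfun.diff_right)
  have Y_lip: "norm (Y v - Y z) \<le> 1 / (\<sigma> * \<eta>) * norm (v - z)" for v z
    using maximizer_lipschitz[of "\<eta> * \<sigma>" Y ?S "\<lambda>y. p y + \<eta> * w y", OF c Y growth]
    by (simp add: mult.commute)
  have gderiv: "GDERIV f\<eta> x :> blinfun_transpose (A' x) (Y (A x))" for x
  proof -
    have "(f\<eta> has_derivative (\<lambda>v. blinfun_apply (Y (A x)) (blinfun_apply (A' x) v))) (at x)"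
      unfolding f\<eta>_eq
      by (rule has_derivative_compose[OF A_deriv has_derivative_lipschitz_subgradient[OF H_sub Y_lip]])
    then show ?thesis
      unfolding gderiv_def by (simp add: inner_blinfun_transpose inner_commute[of _ "blinfun_transpose _ _"])
  qed
  have grad: "gradient f\<eta> = (\<lambda>x. blinfun_transpose (A' x) (Y (A x)))"
    using gradient_eqI[OF gderiv] by blast
  have Y_cont: "continuous_on UNIV Y"
    by (rule lipschitz_on_continuous_on[of "1 / (\<sigma> * \<eta>)"], rule lipschitz_onI)
      (use Y_lip \<sigma> \<eta> in \<open>auto simp: dist_norm\<close>)
  have A_cont: "continuous_on X A"
    using A_deriv by (intro has_derivative_continuous_on) (rule has_derivative_at_withinI)
  have C1: "continuously_differentiable_on X f\<eta>"
    unfolding continuously_differentiable_on_def grad blinfun_transpose_def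
  proof (intro conjI ballI)
    show "GDERIV f\<eta> x :> (\<Sum>b\<in>Basis. blinfun_apply (Y (A x)) (blinfun_apply (A' x) b) *\<^sub>R b)" for x
      using gderiv[of x] by (simp add: blinfun_transpose_def)
    \<comment> \<open>Expanded over the basis, the gradient is a finite sum, continuous because
      \<open>Y\<close>, \<open>A\<close> and \<open>A'\<close> are.\<close>
    show "continuous_on X (\<lambda>x. \<Sum>b\<in>Basis. blinfun_apply (Y (A x)) (blinfun_apply (A' x) b) *\<^sub>R b)"
      by (intro continuous_intros continuous_on_compose2[OF Y_cont A_cont]
          continuous_on_subset[OF A'_cont]) auto
  qed
  have weak: "weakly_convex_on (B * LA) X f\<eta>"
    unfolding f\<eta>_eq using nB[OF Y] H_sub
    by (intro weakly_convex_on_compose[OF X(2) A_deriv A'_lipschitz]) blast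
  have weak_f: "weakly_convex_on (B * LA) X f"
    unfolding f
  proof (intro weakly_convex_on_compose[OF X(2) A_deriv A'_lipschitz])
    fix z
    obtain y where y: "y \<in> ?S" "p y \<le> blinfun_apply y z - h z" using sub by blast
    have "h z + blinfun_apply y (v - z) \<le> h v" for v
      using y(2) fenchel_young[OF y(1), of v] by (simp add: p_def blinfun.diff_right)
    then show "\<exists>y. norm y \<le> B \<and> (\<forall>w. h z + blinfun_apply y (w - z) \<le> h w)"
      using nB[OF y(1)] by blast
  qed
  have lip: "norm (gradient f\<eta> x1 - gradient f\<eta> x2) \<le> L\<eta> x1 x2 * norm (x1 - x2)"
    if "x1 \<in> X" "x2 \<in> X" for x1 x2
    unfolding grad L\<eta> using \<sigma> \<eta>
    by (intro blinfun_transpose_lipschitz[OF A_deriv A'_cont A'_lipschitz that _ nB[OF Y] Y_lip]) simp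
  have L_nonneg: "0 \<le> L\<eta> x1 x2" for x1 x2
  proof -
    have "0 \<le> (SUP \<theta>\<in>{0..1::real}. (norm (A' (\<theta> *\<^sub>R x1 + (1 - \<theta>) *\<^sub>R x2)))\<^sup>2)"
      by (rule order_trans[OF zero_le_power2 norm_on_segment_le_SUP[OF A'_cont, of 0]]) simp
    then show ?thesis unfolding L\<eta> using \<sigma> \<eta> B0 LA0 by (intro add_nonneg_nonneg mult_nonneg_nonneg) auto
  qed
  have L_sym: "L\<eta> x1 x2 = L\<eta> x2 x1" for x1 x2
  proof -
    \<comment> \<open>Swapping the endpoints reverses the segment, and \<open>1 - \<theta>\<close>
      runs through the same interval.\<close>
    have "(\<lambda>\<theta>. (norm (A' (\<theta> *\<^sub>R x1 + (1 - \<theta>) *\<^sub>R x2)))\<^sup>2) ` {0..1}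
        = (\<lambda>\<theta>. (norm (A' (\<theta> *\<^sub>R x2 + (1 - \<theta>) *\<^sub>R x1)))\<^sup>2) ` (\<lambda>\<theta>. 1 - \<theta>) ` {0..1::real}"
      unfolding image_image by (simp add: add.commute)
    then show ?thesis by (simp add: L\<eta>)
  qed
  have "\<exists>r\<ge>0. weakly_convex_on r X f"
    using weak_f B0 LA0 by (intro exI[of _ "B * LA"]) simp
  then have "smooth_approximation X f f\<eta> (B * LA) R\<eta> L\<eta>"
    unfolding smooth_approximation_def
    using weak approx C1 lip L_nonneg L_sym B0 LA0 D0 \<eta> by (auto simp: R\<eta>)
  then show ?thesis
    using approx C1 gderiv weak lip by (simp add: smoothing arg_max yopt_eq)
qed

end
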